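(* Let $(L,\cdot,\alpha)$ be a (left) Hom-Leibniz algebra over a field $\mathbb{K}$ of characteristic $0$. Then $(L,\cdot,\alpha)$ is Hom-Lie admissible if and only if $$(x\cdot y)\cdot\alpha(z) + (y\cdot z)\cdot\alpha(x) + (z\cdot x)\cdot\alpha(y) = 0$$ for all $x,y,z\in L$.
   Context: A Hom-algebra is a triple $(A,\cdot,\alpha)$ where $A$ is a $\mathbb{K}$-vector space, $\cdot$ is a bilinear binary operation on $A$, and $\alpha: A\to A$ is a linear map that is multiplicative: $\alpha(x\cdot y)=\alpha(x)\cdot\alpha(y)$ for all $x,y\in A$. A (left) Hom-Leibniz algebra is a Hom-algebra $(A,\cdot,\alpha)$ such that $\alpha(x)\cdot(y\cdot z) = (x\cdot y)\cdot\alpha(z) + \alpha(y)\cdot(x\cdot z)$ for all $x,y,z\in A$. A Hom-Lie algebra is a Hom-algebra $(A,[-,-],\alpha)$ whose operation $[-,-]$ is skew-symmetric and satisfies the Hom-Jacobi identity $[[x,y],\alpha(z)] + [[y,z],\alpha(x)] + [[z,x],\alpha(y)] = 0$ for all $x,y,z\in A$. A Hom-algebra $(A,\cdot,\alpha)$ is Hom-Lie admissible if $(A,[-,-],\alpha)$ with the commutator $[x,y]:=x\cdot y-y\cdot x$ is a Hom-Lie algebra. *)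

theory Defs
  imports Complex_Main
begin

locale hom_algebra = vector_space scale
  for scale :: "'k::field \<Rightarrow> 'a::ab_group_add \<Rightarrow> 'a" +
  fixes mul :: "'a \<Rightarrow> 'a \<Rightarrow> 'a"
    and \<alpha> :: "'a \<Rightarrow> 'a"
  assumes linear_mul_right: "Vector_Spaces.linear scale scale (\<lambda>y. mul x y)"
    and linear_mul_left: "Vector_Spaces.linear scale scale (\<lambda>x. mul x y)"
    and linear_twist: "Vector_Spaces.linear scale scale \<alpha>"
    and twist_mul: "\<alpha> (mul x y) = mul (\<alpha> x) (\<alpha> y)"

locale left_hom_leibniz_algebra = hom_algebra scale mul \<alpha>
  for scale :: "'k::field \<Rightarrow> 'a::ab_group_add \<Rightarrow> 'a"
    and mul :: "'a \<Rightarrow> 'a \<Rightarrow> 'a"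
    and \<alpha> :: "'a \<Rightarrow> 'a" +
  assumes left_hom_leibniz:
    "mul (\<alpha> x) (mul y z) = mul (mul x y) (\<alpha> z) + mul (\<alpha> y) (mul x z)"

locale hom_lie_algebra = hom_algebra scale br \<alpha>
  for scale :: "'k::field \<Rightarrow> 'a::ab_group_add \<Rightarrow> 'a"
    and br :: "'a \<Rightarrow> 'a \<Rightarrow> 'a"
    and \<alpha> :: "'a \<Rightarrow> 'a" +
  assumes skew_symmetric: "br x y = - br y x"
    and hom_jacobi:
      "br (br x y) (\<alpha> z) + br (br y z) (\<alpha> x) + br (br z x) (\<alpha> y) = 0"

definition commutator :: "('a::ab_group_add \<Rightarrow> 'a \<Rightarrow> 'a) \<Rightarrow> 'a \<Rightarrow> 'a \<Rightarrow> 'a" where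
  "commutator mul x y = mul x y - mul y x"

definition hom_lie_admissible ::
  "('k::field \<Rightarrow> 'a::ab_group_add \<Rightarrow> 'a) \<Rightarrow> ('a \<Rightarrow> 'a \<Rightarrow> 'a) \<Rightarrow> ('a \<Rightarrow> 'a) \<Rightarrow> bool" where
  "hom_lie_admissible scale mul \<alpha> \<longleftrightarrow>
     hom_algebra scale mul \<alpha> \<and> hom_lie_algebra scale (commutator mul) \<alpha>"

end

theory Submission
  imports Defs
begin

text \<open>Write \<open>S\<close> for the cyclic sum of \<open>(x \<cdot> y) \<cdot> \<alpha> z\<close>. Summing the Hom-Leibniz identity over the cyclic
  permutations of \<open>(x, y, z)\<close> and over those of \<open>(y, x, z)\<close> shows that \<open>S x y z = - S y x z\<close> and that the
  Hom-Jacobi sum of the commutator is \<open>- S y x z\<close>. Hence that sum equals \<open>S x y z\<close>.\<close>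

lemma (in hom_algebra) mul_diff_left: "mul (x - y) z = mul x z - mul y z"
  using linear_mul_left by (rule module_hom.diff[OF Vector_Spaces.linear.axioms(3)])

lemma (in hom_algebra) mul_diff_right: "mul x (y - z) = mul x y - mul x z"
  using linear_mul_right by (rule module_hom.diff[OF Vector_Spaces.linear.axioms(3)])

lemma (in hom_algebra) twist_diff: "\<alpha> (x - y) = \<alpha> x - \<alpha> y"
  using linear_twist by (rule module_hom.diff[OF Vector_Spaces.linear.axioms(3)])

lemma (in hom_algebra) hom_algebra_commutator: "hom_algebra scale (commutator mul) \<alpha>"
proof -
  interpret vector_space_pair scale scale ..
  show ?thesis
  proof (intro hom_algebra.intro hom_algebra_axioms.intro)
    show "Vector_Spaces.linear scale scale (\<lambda>y. commutator mul x y)" for x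
      unfolding commutator_def by (intro linear_compose_sub linear_mul_left linear_mul_right)
    show "Vector_Spaces.linear scale scale (\<lambda>x. commutator mul x y)" for y
      unfolding commutator_def by (intro linear_compose_sub linear_mul_left linear_mul_right)
    show "\<alpha> (commutator mul x y) = commutator mul (\<alpha> x) (\<alpha> y)" for x y
      by (simp add: commutator_def twist_diff twist_mul)
  qed (rule vector_space_axioms linear_twist)+
qed

lemma (in left_hom_leibniz_algebra) hom_jacobi_sum_commutator:
  "commutator mul (commutator mul x y) (\<alpha> z) + commutator mul (commutator mul y z) (\<alpha> x)
      + commutator mul (commutator mul z x) (\<alpha> y)
    = mul (mul x y) (\<alpha> z) + mul (mul y z) (\<alpha> x) + mul (mul z x) (\<alpha> y)"
proof -
  \<comment> \<open>Oriented this way, the identity eliminates every product nested on the left, so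
    both sides reduce to the same signed sum of six terms of the form
    \<open>mul (\<alpha> a) (mul b c)\<close>.\<close>
  have leibniz: "mul (mul a b) (\<alpha> c) = mul (\<alpha> a) (mul b c) - mul (\<alpha> b) (mul a c)" for a b c
    using left_hom_leibniz[of a b c] by simp
  show ?thesis
    by (simp add: commutator_def mul_diff_left mul_diff_right leibniz)
qed

theorem corollary3p4:
  fixes scale :: "'k::field_char_0 \<Rightarrow> 'l::ab_group_add \<Rightarrow> 'l"
    and mul :: "'l \<Rightarrow> 'l \<Rightarrow> 'l"
    and \<alpha> :: "'l \<Rightarrow> 'l"
  assumes "left_hom_leibniz_algebra scale mul \<alpha>"
  shows "hom_lie_admissible scale mul \<alpha> \<longleftrightarrow>
    (\<forall>x y z. mul (mul x y) (\<alpha> z) + mul (mul y z) (\<alpha> x) + mul (mul z x) (\<alpha> y) = 0)"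
proof -
  interpret left_hom_leibniz_algebra scale mul \<alpha> by fact
  have "commutator mul x y = - commutator mul y x" for x y
    by (simp add: commutator_def)
  \<comment> \<open>The Hom-algebra axioms and skew-symmetry hold for the commutator in any case, so
    admissibility amounts to the Hom-Jacobi identity, whose left side is rewritten to the cyclic
    sum.\<close>
  with hom_algebra_axioms hom_algebra_commutator show ?thesis
    unfolding hom_lie_admissible_def hom_lie_algebra_def hom_lie_algebra_axioms_def
      hom_jacobi_sum_commutator
    by blast
qed

end
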